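(* Let $G$ be a finite group with irreducible complex characters $\chi_1,\dots,\chi_k$, and let $N$ be a normal subgroup of $G$ contained in the center $Z(G)$. Let $\zeta$ be the character of a one-dimensional complex representation of $N$, and define $\zeta_0\in\mathrm{Map}(G,\mathbb{C})$ by $\zeta_0(g)=\zeta(g)$ for $g\in N$ and $\zeta_0(g)=0$ for $g\notin N$. Let $m\ge1$ be an integer such that $m\zeta_0$ is a character of $G$. For $g\in G$ let $O_N(g)$ be the order of the image of $g$ in $G/N$. Then: (1) For every $g\in G$, with $h=O_N(g)$, $$\lambda_t(m\zeta_0)(g)=\bigl(1-\zeta(g^h)(-t)^h\bigr)^{\frac{m}{h}}.$$ (2) For every $j=1,\dots,k$, $$\langle\chi_j,S_t(m\zeta_0)\rangle_G=\frac{1}{|G|}\sum_{g\in G}\chi_j(g)\bigl(1-\zeta(g^{-O_N(g)})\,t^{O_N(g)}\bigr)^{-\frac{m}{O_N(g)}},$$ $$\langle\chi_j,\lambda_t(m\zeta_0)\rangle_G=\frac{1}{|G|}\sum_{g\in G}\chi_j(g)\bigl(1-\zeta(g^{-O_N(g)})(-t)^{O_N(g)}\bigr)^{\frac{m}{O_N(g)}}.$$ (3) In particular, if $n\ge1$ satisfies $\gcd(n,|G/N|)=1$, then $$S^n(m\zeta_0)=\binom{m+n-1}{n}\zeta_0^n,\qquad \lambda^n(m\zeta_0)=\binom{m}{n}\zeta_0^n.$$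
   Context: For a finite group $G$, $\mathrm{Map}(G,\mathbb{C})$ is the commutative $\mathbb{C}$-algebra of all functions $G\to\mathbb{C}$ with pointwise operations (so $\zeta_0^n$ is the pointwise $n$-th power). Adams operations: $\psi^n(f)(g)=f(g^n)$ for $n\ge1$. The $\lambda$-operations $\lambda^i$ ($i\ge 0$) on $\mathrm{Map}(G,\mathbb{C})$ are defined by letting $\lambda_t(f)=\sum_{i\ge0}\lambda^i(f)t^i$ be the unique formal power series over $\mathrm{Map}(G,\mathbb{C})$ with constant term $1$ satisfying $\sum_{n\ge1}\psi^n(f)(-t)^n=-t\,\bigl(\tfrac{d}{dt}\lambda_t(f)\bigr)\lambda_t(f)^{-1}$. The symmetric power operations $S^i$ are defined by $S_t(f)=\sum_{i\ge0}S^i(f)t^i=(\lambda_{-t}(f))^{-1}$. (If $\chi$ is the character of a finite-dimensional complex representation $V$, then $\lambda^i(\chi)$ and $S^i(\chi)$ are the characters of $\bigwedge^i V$ and $S^i(V)$.) For $g\in G$, $\lambda_t(f)(g)=\sum_i\lambda^i(f)(g)t^i\in\mathbb{C}[[t]]$. Inner product: $\langle f,f'\rangle_G=\frac1{|G|}\sum_{g\in G}f(g)f'(g^{-1})$, and $\langle\chi_j,S_t(\chi)\rangle_G=\sum_{i\ge0}\langle\chi_j,S^i(\chi)\rangle_Gt^i$, $\langle\chi_j,\lambda_t(\chi)\rangle_G=\sum_{i\ge0}\langle\chi_j,\lambda^i(\chi)\rangle_Gt^i$. Powers of series are binomial series: $(1+t)^r=\sum_{i\ge0}\binom{r}{i}t^i$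 with $\binom{r}{i}=r(r-1)\cdots(r-i+1)/i!$, with a series of zero constant term substituted for $t$. *)

theory Defs
  imports
    "HOL-Algebra.Algebra"
    "HOL-Computational_Algebra.Formal_Power_Series"
    "HOL-Library.Function_Division"
    "Jordan_Normal_Form.VS_Connect"
begin

definition center :: "('a, 'b) monoid_scheme \<Rightarrow> 'a set" where
  "center G = {z \<in> carrier G. \<forall>g \<in> carrier G. z \<otimes>\<^bsub>G\<^esub> g = g \<otimes>\<^bsub>G\<^esub> z}"


section \<open>Complex representations and characters\<close>

text \<open>Representations of dimension \<open>d\<close> are given in coordinates, as homomorphisms
  \<open>G \<rightarrow> GL\<^sub>d(\<complex>)\<close>.\<close>

definition representation ::
  "('a, 'b) monoid_scheme \<Rightarrow> nat \<Rightarrow> ('a \<Rightarrow> complex mat) \<Rightarrow> bool" where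
  "representation G d \<rho> \<longleftrightarrow> \<rho> \<in> hom G (units_of (ring_mat TYPE(complex) d ()))"

definition irreducible_representation ::
  "('a, 'b) monoid_scheme \<Rightarrow> nat \<Rightarrow> ('a \<Rightarrow> complex mat) \<Rightarrow> bool" where
  "irreducible_representation G d \<rho> \<longleftrightarrow>
     representation G d \<rho> \<and> d > 0 \<and>
     (\<forall>W. VectorSpace.subspace class_ring W (module_vec TYPE(complex) d) \<and>
          (\<forall>g \<in> carrier G. \<forall>w \<in> W. \<rho> g *\<^sub>v w \<in> W)
        \<longrightarrow> W = {0\<^sub>v d} \<or> W = carrier_vec d)"

definition mat_trace :: "complex mat \<Rightarrow> complex" where
  "mat_trace A = (\<Sum>i<dim_row A. A $$ (i, i))"

text \<open>An element of \<open>Map(G, \<complex>)\<close> is represented by the function on the whole type that agrees with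
  it on \<open>carrier G\<close> and is \<open>0\<close> elsewhere, so that equality in \<open>Map(G, \<complex>)\<close> is equality of
  HOL functions.\<close>

definition rep_character ::
  "('a, 'b) monoid_scheme \<Rightarrow> ('a \<Rightarrow> complex mat) \<Rightarrow> 'a \<Rightarrow> complex" where
  "rep_character G \<rho> = (\<lambda>g. if g \<in> carrier G then mat_trace (\<rho> g) else 0)"

definition characters_of_dim :: "('a, 'b) monoid_scheme \<Rightarrow> nat \<Rightarrow> ('a \<Rightarrow> complex) set" where
  "characters_of_dim G d = {rep_character G \<rho> | \<rho>. representation G d \<rho>}"

definition characters :: "('a, 'b) monoid_scheme \<Rightarrow> ('a \<Rightarrow> complex) set" where
  "characters G = (\<Union>d. characters_of_dim G d)"

definition irreducible_characters :: "('a, 'b) monoid_scheme \<Rightarrow> ('a \<Rightarrow> complex) set" where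
  "irreducible_characters G = {rep_character G \<rho> | d \<rho>. irreducible_representation G d \<rho>}"

definition char_inner ::
  "('a, 'b) monoid_scheme \<Rightarrow> ('a \<Rightarrow> complex) \<Rightarrow> ('a \<Rightarrow> complex) \<Rightarrow> complex" where
  "char_inner G f f' = 1 / of_nat (Coset.order G) * (\<Sum>g \<in> carrier G. f g * f' (inv\<^bsub>G\<^esub> g))"


section \<open>Adams, exterior and symmetric power operations\<close>

definition adams :: "('a, 'b) monoid_scheme \<Rightarrow> nat \<Rightarrow> ('a \<Rightarrow> complex) \<Rightarrow> 'a \<Rightarrow> complex" where
  "adams G n f = (\<lambda>g. if g \<in> carrier G then f (g [^]\<^bsub>G\<^esub> n) else 0)"

text \<open>The series ring used below is \<^typ>\<open>('a \<Rightarrow> complex) fps\<close>, with the pointwise ring structure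
  (and pointwise \<^const>\<open>inverse\<close>) on \<^typ>\<open>'a \<Rightarrow> complex\<close>. Its unit is \<open>1\<close> also outside
  \<open>carrier G\<close>; there the Adams operations vanish, so the defining equation forces the series
  to be the constant \<open>1\<close> at such points.\<close>

definition adams_series ::
  "('a, 'b) monoid_scheme \<Rightarrow> ('a \<Rightarrow> complex) \<Rightarrow> ('a \<Rightarrow> complex) fps" where
  "adams_series G f = Abs_fps (\<lambda>n. if n = 0 then 0 else (- 1) ^ n * adams G n f)"

definition lambda_series ::
  "('a, 'b) monoid_scheme \<Rightarrow> ('a \<Rightarrow> complex) \<Rightarrow> ('a \<Rightarrow> complex) fps" where
  "lambda_series G f = (THE L. fps_nth L 0 = 1 \<and>
     adams_series G f = - fps_X * fps_deriv L * inverse L)"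

text \<open>The description is well-defined: the coefficients are determined recursively, at each
  point \<open>g\<close> separately.\<close>

lemma fun_fps_inverse_right:
  fixes L :: "('a \<Rightarrow> complex) fps"
  assumes "fps_nth L 0 = 1"
  shows "L * inverse L = 1"
proof -
  have "inverse (1 :: 'a \<Rightarrow> complex) = 1"
    by (simp add: fun_eq_iff)
  thus ?thesis
    using fps_right_inverse[of L "inverse (fps_nth L 0)"] assms
    by (simp add: fps_inverse_def)
qed

fun lambda_coeff :: "(nat \<Rightarrow> complex) \<Rightarrow> nat \<Rightarrow> complex" where
  "lambda_coeff a 0 = 1"
| "lambda_coeff a (Suc n) =
     - (\<Sum>i\<in>{0..n}. lambda_coeff a i * a (Suc n - i)) / of_nat (Suc n)"

lemma lambda_series_iff:
  fixes A L :: "('a \<Rightarrow> complex) fps"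
  assumes A0: "fps_nth A 0 = 0"
  shows "fps_nth L 0 = 1 \<and> A = - fps_X * fps_deriv L * inverse L \<longleftrightarrow>
         L = Abs_fps (\<lambda>n g. lambda_coeff (\<lambda>i. fps_nth A i g) n)"
    (is "_ \<longleftrightarrow> L = ?R")
proof -
  have of_nat_fun: "of_nat n = (\<lambda>_::'a. of_nat n :: complex)" for n
    by (induction n) (auto simp: fun_eq_iff)
  have sum_fun: "sum f S x = (\<Sum>i\<in>S. f i x)"
    for f :: "nat \<Rightarrow> 'a \<Rightarrow> complex" and S x
    by (induction S rule: infinite_finite_induct) auto
  have neg_X: "- fps_X * D = - (fps_X * D)" for D :: "('a \<Rightarrow> complex) fps"
    by simp
  have mult: "A = - fps_X * fps_deriv L * inverse L \<longleftrightarrow> L * A = - fps_X * fps_deriv L"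
    if "fps_nth L 0 = 1"
  proof
    assume "A = - fps_X * fps_deriv L * inverse L"
    hence "L * A = - fps_X * fps_deriv L * (L * inverse L)"
      by (simp add: mult_ac)
    thus "L * A = - fps_X * fps_deriv L"
      by (simp add: fun_fps_inverse_right[OF that])
  next
    assume eq: "L * A = - fps_X * fps_deriv L"
    have "A = A * (L * inverse L)"
      by (simp add: fun_fps_inverse_right[OF that])
    also have "\<dots> = - fps_X * fps_deriv L * inverse L"
      using eq by (metis mult.assoc mult.commute)
    finally show "A = - fps_X * fps_deriv L * inverse L" .
  qed
  have "L * A = - fps_X * fps_deriv L \<longleftrightarrow>
      (\<forall>n g. (\<Sum>i\<in>{0..n}. fps_nth L i g * fps_nth A (Suc n - i) g) =
        - (of_nat (Suc n) * fps_nth L (Suc n) g))" (is "?lhs \<longleftrightarrow> ?rhs")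
  proof -
    have L0: "fps_nth (L * A) 0 = 0" "fps_nth (- fps_X * fps_deriv L) 0 = 0"
      using A0 by (simp_all add: neg_X)
    have L: "fps_nth (L * A) (Suc n) g = (\<Sum>i\<in>{0..n}. fps_nth L i g * fps_nth A (Suc n - i) g)"
      for n g
      using A0 by (simp add: fps_mult_nth sum_fun)
    have R: "fps_nth (- fps_X * fps_deriv L) (Suc n) g = - (of_nat (Suc n) * fps_nth L (Suc n) g)"
      for n g
      unfolding neg_X by (simp add: of_nat_fun)
    have "?lhs \<longleftrightarrow> (\<forall>n. fps_nth (L * A) n = fps_nth (- fps_X * fps_deriv L) n)"
      by (simp only: fps_eq_iff)
    also have "\<dots> \<longleftrightarrow> (\<forall>n. fps_nth (L * A) (Suc n) = fps_nth (- fps_X * fps_deriv L) (Suc n))"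
      using L0 by (metis not0_implies_Suc)
    finally show ?thesis
      by (simp only: fun_eq_iff L R)
  qed
  also have "\<dots> \<longleftrightarrow> (\<forall>n g. fps_nth L (Suc n) g =
      - (\<Sum>i\<in>{0..n}. fps_nth L i g * fps_nth A (Suc n - i) g) / of_nat (Suc n))"
  proof -
    have "s = - (of_nat (Suc n) * c) \<longleftrightarrow> c = - s / of_nat (Suc n)" for s c :: complex and n
      by (metis (no_types, lifting) minus_equation_iff nonzero_mult_div_cancel_left nonzero_eq_divide_eq mult.commute of_nat_neq_0)
    thus ?thesis by blast
  qed
  finally have rec: "L * A = - fps_X * fps_deriv L \<longleftrightarrow>
    (\<forall>n g. fps_nth L (Suc n) g =
      - (\<Sum>i\<in>{0..n}. fps_nth L i g * fps_nth A (Suc n - i) g) / of_nat (Suc n))" .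
  have "fps_nth L 0 = 1 \<and> (\<forall>n g. fps_nth L (Suc n) g =
      - (\<Sum>i\<in>{0..n}. fps_nth L i g * fps_nth A (Suc n - i) g) / of_nat (Suc n)) \<longleftrightarrow> L = ?R"
    (is "?P \<longleftrightarrow> _")
  proof
    assume P: ?P
    have "fps_nth L n g = lambda_coeff (\<lambda>i. fps_nth A i g) n" for n g
    proof (induction n rule: less_induct)
      case (less n)
      show ?case
      proof (cases n)
        case (Suc k)
        have "(\<Sum>i\<in>{0..k}. fps_nth L i g * fps_nth A (Suc k - i) g) =
            (\<Sum>i\<in>{0..k}. lambda_coeff (\<lambda>i. fps_nth A i g) i * fps_nth A (Suc k - i) g)"
          by (intro sum.cong refl) (simp add: less.IH Suc)
        with P Suc show ?thesis by simp
      qed (use P in simp)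
    qed
    thus "L = ?R" by (simp add: fps_eq_iff fun_eq_iff)
  next
    assume "L = ?R"
    thus ?P by (simp add: fun_eq_iff)
  qed
  with rec mult show ?thesis by blast
qed

lemma lambda_series_ex1:
  "\<exists>!L. fps_nth L 0 = 1 \<and> adams_series G f = - fps_X * fps_deriv L * inverse L"
proof -
  have "fps_nth (adams_series G f) 0 = 0"
    by (simp add: adams_series_def)
  thus ?thesis
    by (simp only: lambda_series_iff ex1_eq)
qed

definition lambda_op :: "('a, 'b) monoid_scheme \<Rightarrow> nat \<Rightarrow> ('a \<Rightarrow> complex) \<Rightarrow> 'a \<Rightarrow> complex" where
  "lambda_op G i f = fps_nth (lambda_series G f) i"

definition sym_series ::
  "('a, 'b) monoid_scheme \<Rightarrow> ('a \<Rightarrow> complex) \<Rightarrow> ('a \<Rightarrow> complex) fps" where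
  "sym_series G f = inverse (lambda_series G f oo (- fps_X))"

definition sym_op :: "('a, 'b) monoid_scheme \<Rightarrow> nat \<Rightarrow> ('a \<Rightarrow> complex) \<Rightarrow> 'a \<Rightarrow> complex" where
  "sym_op G i f = fps_nth (sym_series G f) i"

definition series_at :: "('a \<Rightarrow> complex) fps \<Rightarrow> 'a \<Rightarrow> complex fps" where
  "series_at L g = Abs_fps (\<lambda>i. fps_nth L i g)"

definition char_inner_series ::
  "('a, 'b) monoid_scheme \<Rightarrow> ('a \<Rightarrow> complex) \<Rightarrow> ('a \<Rightarrow> complex) fps \<Rightarrow> complex fps" where
  "char_inner_series G f L = Abs_fps (\<lambda>i. char_inner G f (fps_nth L i))"

text \<open>The binomial power \<open>(1 + u)\<^sup>r\<close> of a series \<open>u\<close> with zero constant term.\<close>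

definition one_plus_power :: "complex fps \<Rightarrow> complex \<Rightarrow> complex fps" where
  "one_plus_power u r = fps_binomial r oo u"

definition quotient_ord :: "('a, 'b) monoid_scheme \<Rightarrow> 'a set \<Rightarrow> 'a \<Rightarrow> nat" where
  "quotient_ord G N g = group.ord (G Mod N) (N #>\<^bsub>G\<^esub> g)"

end

theory Submission
  imports Defs
begin

text \<open>
  At a point \<open>g\<close> whose image in \<open>G/N\<close> has order \<open>h\<close>, the power \<open>g\<^sup>n\<close> lies in \<open>N\<close> exactly when
  \<open>h\<close> divides \<open>n\<close>, so the Adams series of \<open>m\<zeta>\<^sub>0\<close> at \<open>g\<close> is the geometric series
  \<open>m (w t\<^sup>h + w\<^sup>2 t\<^sup>2\<^sup>h + \<dots>)\<close> with \<open>w = (-1)\<^sup>h \<zeta>(g\<^sup>h)\<close>.  The binomial power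
  \<open>(1 - w t\<^sup>h)\<^bsup>m/h\<^esup>\<close> has this series as the negative of its logarithmic derivative (times \<open>t\<close>),
  which determines it.  Only exponents divisible by \<open>h\<close> occur in it, and \<open>h\<close> divides \<open>|G/N|\<close>,
  so in degrees coprime to \<open>|G/N|\<close> only the points with \<open>h = 1\<close>, i.e. those of \<open>N\<close>, contribute.
\<close>

section \<open>Logarithmic derivatives and binomial powers of complex series\<close>

text \<open>Comparing coefficients in \<open>eq\<close> gives the recursion of
  \<open>lambda_coeff\<close>. A closed form for the lambda series at a point is thus recognised by
  its constant term and its differential equation.\<close>

lemma lambda_coeff_eqI:
  fixes P A :: "complex fps"
  assumes P0: "fps_nth P 0 = 1" and A0: "fps_nth A 0 = 0"
    and eq: "P * A = - (fps_X * fps_deriv P)"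
  shows "lambda_coeff (fps_nth A) n = fps_nth P n"
proof (induction n rule: less_induct)
  case (less n)
  show ?case
  proof (cases n)
    case (Suc k)
    have "(\<Sum>i\<in>{0..k}. lambda_coeff (fps_nth A) i * fps_nth A (Suc k - i)) =
        (\<Sum>i\<in>{0..k}. fps_nth P i * fps_nth A (Suc k - i))"
      by (intro sum.cong refl) (simp add: less.IH Suc)
    also have "\<dots> = fps_nth (P * A) (Suc k)"
      using A0 by (simp add: fps_mult_nth)
    also have "\<dots> = - (of_nat (Suc k) * fps_nth P (Suc k))"
      by (simp add: eq)
    finally show ?thesis
      by (simp add: Suc del: of_nat_Suc)
  qed (use P0 in simp)
qed

lemma one_plus_power_nth_0 [simp]: "fps_nth (one_plus_power u r) 0 = 1"
  by (simp add: one_plus_power_def)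

text \<open>The chain rule carries the equation (1 + X) B' = r B of the binomial series B over to
  the substituted series.\<close>

lemma one_plus_power_deriv:
  assumes u0: "fps_nth u 0 = 0"
  shows "(1 + u) * fps_deriv (one_plus_power u r) =
    fps_const r * fps_deriv u * one_plus_power u r"
proof -
  have u_unit: "fps_nth (1 + u) 0 \<noteq> 0"
    using u0 by simp
  have "fps_deriv (fps_binomial r) = fps_const r * fps_binomial r * inverse (1 + fps_X)"
    by (simp add: fps_binomial_deriv fps_divide_unit)
  hence "fps_deriv (one_plus_power u r) =
      fps_const r * one_plus_power u r * inverse (1 + u) * fps_deriv u"
    using u0
    by (simp add: one_plus_power_def fps_compose_deriv fps_compose_mult_distrib
        fps_inverse_compose fps_compose_add_distrib)
  thus ?thesis
    using inverse_mult_eq_1'[OF u_unit] by (simp add: mult_ac)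
qed

lemma one_plus_power_inverse:
  assumes u0: "fps_nth u 0 = 0"
  shows "one_plus_power u r * one_plus_power u (- r) = 1"
  using u0 fps_binomial_add_mult[of r "- r"]
  by (simp add: one_plus_power_def flip: fps_compose_mult_distrib)

lemma one_plus_power_compose:
  assumes "fps_nth u 0 = 0" "fps_nth v 0 = 0"
  shows "one_plus_power u r oo v = one_plus_power (u oo v) r"
  using assms by (simp add: one_plus_power_def fps_compose_assoc)

text \<open>The i-th power of the monomial lives in degree h * i only, so at most i = n div h
  contributes.\<close>

lemma one_plus_power_monomial_nth:
  assumes "h > 0"
  shows "fps_nth (one_plus_power (fps_const w * fps_X ^ h) r) n =
    (if h dvd n then (r gchoose (n div h)) * w ^ (n div h) else 0)"
proof -
  have "fps_nth (one_plus_power (fps_const w * fps_X ^ h) r) n =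
      (\<Sum>i\<in>{0..n}. if n = h * i then (r gchoose i) * w ^ i else 0)"
    unfolding one_plus_power_def fps_compose_nth
    by (intro sum.cong refl)
      (simp add: power_mult_distrib fps_const_power flip: power_mult)
  also have "\<dots> = (\<Sum>i\<in>{0..n}. if i = n div h then
      (if h dvd n then (r gchoose i) * w ^ i else 0) else 0)"
    using assms by (intro sum.cong refl) auto
  also have "\<dots> = (if h dvd n then (r gchoose (n div h)) * w ^ (n div h) else 0)"
    by simp
  finally show ?thesis .
qed

text \<open>Put u = - w X^h. Summing the geometric series gives A (1 + u) = - c u, and the
  differential equation of the binomial power gives X (1 + u) P' = c u P. So both sides agree after
  multiplication by 1 + u, which is nonzero and cancels.\<close>

lemma geometric_series_eq_log_deriv:
  fixes w c :: complex
  assumes h: "h > 0"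
  defines "A \<equiv> Abs_fps (\<lambda>n. if n > 0 \<and> h dvd n then c * w ^ (n div h) else 0)"
    and "P \<equiv> one_plus_power (- (fps_const w * fps_X ^ h)) (c / of_nat h)"
  shows "P * A = - (fps_X * fps_deriv P)"
proof -
  define u where "u = - (fps_const w * fps_X ^ h)"
  have u0: "fps_nth u 0 = 0"
    using h by (simp add: u_def)
  have u_unit: "1 + u \<noteq> 0"
    using u0 by (metis add.right_neutral fps_add_nth fps_one_nth fps_zero_nth zero_neq_one)
  have A_mult: "A * (1 + u) = A - fps_const w * (A * fps_X ^ h)"
    by (simp add: u_def algebra_simps)
  have A_geom: "A * (1 + u) = - (fps_const c * u)"
  proof (rule fps_ext)
    fix n
    have "fps_nth (A * (1 + u)) n =
        fps_nth A n - w * (if n < h then 0 else fps_nth A (n - h))"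
      unfolding A_mult by (simp add: fps_X_power_mult_right_nth)
    also have "\<dots> = (if n = h then c * w else 0)"
    proof -
      \<comment> \<open>Above degree h the two terms cancel. At n = h the shifted coefficient has
        degree 0, where the guard n > 0 makes it vanish, so c * w is left over.\<close>
      consider "n < h" | "n = h" | k where "n = h + k" "k > 0"
        by (metis less_imp_add_positive nat_neq_iff)
      thus ?thesis
      proof cases
        case 1
        thus ?thesis by (auto simp: A_def dest: dvd_imp_le)
      next
        case 2
        thus ?thesis using h by (simp add: A_def)
      next
        case 3
        thus ?thesis using h by (simp add: A_def div_add_self1)
      qed
    qed
    also have "\<dots> = fps_nth (- (fps_const c * u)) n"
      by (simp add: u_def)
    finally show "fps_nth (A * (1 + u)) n = fps_nth (- (fps_const c * u)) n" .
  qed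
  have "fps_X * (fps_const (of_nat h) * fps_X ^ (h - 1)) = fps_const (of_nat h :: complex) * fps_X ^ h"
    using h by (cases h) (simp_all add: mult_ac)
  \<comment> \<open>The operator X d/dX multiplies a monomial of degree h by h; the denominator of
    the exponent c / h absorbs this factor.\<close>
  hence Xu: "fps_X * fps_deriv u = fps_const (of_nat h) * u"
    by (simp add: u_def fps_deriv_power fps_of_nat mult_ac)
  have "(1 + u) * (P * A) = - (fps_const c * u) * P"
    using A_geom by (metis mult.commute mult.left_commute)
  also have "\<dots> = - (fps_const (c / of_nat h) * (fps_const (of_nat h) * u) * P)"
    using h by (simp add: fps_const_mult flip: mult.assoc)
  also have "\<dots> = - (fps_X * ((1 + u) * fps_deriv P))"
    unfolding P_def u_def[symmetric] one_plus_power_deriv[OF u0] Xu[symmetric]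
    by (simp add: mult_ac)
  also have "\<dots> = (1 + u) * - (fps_X * fps_deriv P)"
    by (simp add: mult_ac)
  finally show ?thesis
    using u_unit by (metis mult_left_cancel)
qed

section \<open>Lambda and symmetric power series at a single group element\<close>

text \<open>\<open>lambda_series_iff\<close> resolves the definite description into a recursion in
  the values at \<open>g\<close> alone, which reduces the work to complex power series.\<close>

lemma lambda_series_nth:
  "fps_nth (lambda_series G f) n g = lambda_coeff (\<lambda>i. fps_nth (adams_series G f) i g) n"
proof -
  have "fps_nth (adams_series G f) 0 = 0"
    by (simp add: adams_series_def)
  hence "lambda_series G f = Abs_fps (\<lambda>n g. lambda_coeff (\<lambda>i. fps_nth (adams_series G f) i g) n)"
    unfolding lambda_series_def by (simp only: lambda_series_iff the_eq_trivial)
  thus ?thesis by simp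
qed

lemma neg_fun_power: "((- 1) ^ n :: 'a \<Rightarrow> 'b::ring_1) g = (- 1) ^ n"
  by (induction n) simp_all

lemma sum_fun_apply: "sum f S g = (\<Sum>i\<in>S. f i g)" for f :: "'i \<Rightarrow> 'a \<Rightarrow> 'b::comm_monoid_add"
  by (induction S rule: infinite_finite_induct) auto

lemma fps_const_uminus_X_power:
  fixes c :: "'a::comm_ring_1"
  shows "fps_const c * (- fps_X) ^ h = fps_const ((- 1) ^ h * c) * fps_X ^ h"
proof -
  have "(- fps_X :: 'a fps) ^ h = fps_const ((- 1) ^ h) * fps_X ^ h"
    by (subst power_minus) (simp flip: fps_const_power fps_const_neg)
  thus ?thesis by (simp flip: fps_const_mult add: mult_ac)
qed

lemma lambda_series_at_periodic:
  assumes g: "g \<in> carrier G" and h: "h > 0"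
    and f: "\<And>n. n > 0 \<Longrightarrow> f (g [^]\<^bsub>G\<^esub> n) = (if h dvd n then c * z ^ (n div h) else 0)"
  shows "series_at (lambda_series G f) g =
    one_plus_power (- (fps_const z * (- fps_X) ^ h)) (c / of_nat h)"
proof -
  \<comment> \<open>If h divides n, the sign (-1)^n of the Adams series is ((-1)^h)^(n div h), so
    the ratio of the geometric series can absorb it.\<close>
  define w where "w = (- 1) ^ h * z"
  define A where "A = Abs_fps (\<lambda>n. if n > 0 \<and> h dvd n then c * w ^ (n div h) else 0)"
  define P where "P = one_plus_power (- (fps_const w * fps_X ^ h)) (c / of_nat h)"
  have "fps_nth (adams_series G f) n g = fps_nth A n" for n
    using g f[of n]
    by (auto simp: adams_series_def adams_def A_def w_def neg_fun_power power_mult_distrib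
        simp flip: power_mult)
  hence "fps_nth (lambda_series G f) n g = lambda_coeff (fps_nth A) n" for n
    by (simp add: lambda_series_nth)
  also have "lambda_coeff (fps_nth A) n = fps_nth P n" for n
    using geometric_series_eq_log_deriv[OF h, of w c]
    by (intro lambda_coeff_eqI) (simp_all add: A_def P_def)
  finally show ?thesis
    by (simp add: series_at_def fps_eq_iff P_def w_def fps_const_uminus_X_power)
qed

text \<open>Evaluation at \<open>g\<close> respects products and the substitution of -X, so the
  inverse may be taken at \<open>g\<close>, where it negates the exponent.\<close>

lemma sym_series_at:
  assumes "series_at (lambda_series G f) g = one_plus_power u r" and u0: "fps_nth u 0 = 0"
  shows "series_at (sym_series G f) g = one_plus_power (u oo - fps_X) (- r)"
proof -
  define L where "L = lambda_series G f oo - fps_X"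
  have "fps_nth (adams_series G f) 0 = 0"
    by (simp add: adams_series_def)
  hence "fps_nth (lambda_series G f) 0 = 1"
    by (simp add: fun_eq_iff lambda_series_nth)
  hence "L * sym_series G f = 1"
    by (simp add: L_def sym_series_def fun_fps_inverse_right)
  hence "series_at L g * series_at (sym_series G f) g = 1"
    by (simp add: fps_eq_iff series_at_def fps_mult_nth fun_eq_iff sum_fun_apply)
  moreover have "series_at L g = series_at (lambda_series G f) g oo - fps_X"
    by (simp add: L_def series_at_def fps_compose_uminus' neg_fun_power)
  hence "series_at L g = one_plus_power (u oo - fps_X) r"
    by (simp add: assms one_plus_power_compose)
  ultimately have "series_at (sym_series G f) g = inverse (one_plus_power (u oo - fps_X) r)"
    by (metis fps_inverse_unique)
  also have "\<dots> = one_plus_power (u oo - fps_X) (- r)"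
    using u0 by (intro fps_inverse_unique one_plus_power_inverse) simp
  finally show ?thesis .
qed

text \<open>Substituting -X once more cancels the sign in \<open>(- fps_X) ^ h\<close>.\<close>

lemma sym_series_at_periodic:
  assumes "g \<in> carrier G" and h: "h > 0"
    and "\<And>n. n > 0 \<Longrightarrow> f (g [^]\<^bsub>G\<^esub> n) = (if h dvd n then c * z ^ (n div h) else 0)"
  shows "series_at (sym_series G f) g =
    one_plus_power (- (fps_const z * fps_X ^ h)) (- (c / of_nat h))"
proof -
  let ?u = "- (fps_const z * (- fps_X) ^ h)"
  have "?u oo - fps_X = - (fps_const z * fps_X ^ h)"
    by (simp add: fps_compose_uminus fps_compose_mult_distrib flip: fps_compose_power)
  thus ?thesis
    using sym_series_at[OF lambda_series_at_periodic[OF assms]] h by simp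
qed

text \<open>The inner product is linear in its second argument, so closed forms at single points can
  be inserted. The inverses are the source of the negative powers of g inside \<zeta>.\<close>

lemma char_inner_series_eq:
  assumes "group G"
  shows "char_inner_series G f L = fps_const (1 / of_nat (Coset.order G)) *
    (\<Sum>g \<in> carrier G. fps_const (f g) * series_at L (inv\<^bsub>G\<^esub> g))"
  by (simp add: fps_eq_iff char_inner_series_def char_inner_def series_at_def fps_sum_nth)

section \<open>One-dimensional characters\<close>

text \<open>The trace of a 1 x 1 matrix is its only entry, hence multiplicative.\<close>

lemma linear_character_mult:
  assumes "\<zeta> \<in> characters_of_dim H 1" "group H" "x \<in> carrier H" "y \<in> carrier H"
  shows "\<zeta> (x \<otimes>\<^bsub>H\<^esub> y) = \<zeta> x * \<zeta> y"
proof -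
  obtain \<rho> where \<rho>: "representation H 1 \<rho>" and \<zeta>: "\<zeta> = rep_character H \<rho>"
    using assms(1) by (auto simp: characters_of_dim_def)
  have hom: "\<rho> \<in> hom H (units_of (ring_mat TYPE(complex) 1 ()))"
    using \<rho> by (simp add: representation_def)
  have dim: "\<rho> a \<in> carrier_mat 1 1" if "a \<in> carrier H" for a
    using hom_carrier[OF hom] that by (auto simp: units_of_def Units_def ring_mat_def)
  have "\<rho> (x \<otimes>\<^bsub>H\<^esub> y) = \<rho> x * \<rho> y"
    using hom_mult[OF hom] assms by (simp add: units_of_def ring_mat_def)
  thus ?thesis
    using assms dim[of x] dim[of y]
    by (simp add: \<zeta> rep_character_def mat_trace_def monoid.m_closed[OF group.is_monoid]
        scalar_prod_def)
qed

lemma linear_character_one: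
  assumes "\<zeta> \<in> characters_of_dim H 1" "group H"
  shows "\<zeta> \<one>\<^bsub>H\<^esub> = 1"
proof -
  obtain \<rho> where \<rho>: "representation H 1 \<rho>" and \<zeta>: "\<zeta> = rep_character H \<rho>"
    using assms(1) by (auto simp: characters_of_dim_def)
  have "\<rho> \<in> hom H (units_of (ring_mat TYPE(complex) 1 ()))"
    using \<rho> by (simp add: representation_def)
  moreover have "group (units_of (ring_mat TYPE(complex) 1 ()))"
    by (intro monoid.units_group ring.is_monoid ring_mat)
  ultimately have "\<rho> \<one>\<^bsub>H\<^esub> = \<one>\<^bsub>units_of (ring_mat TYPE(complex) 1 ())\<^esub>"
    using assms(2) by (intro hom_one)
  thus ?thesis
    using assms(2)
    by (simp add: \<zeta> rep_character_def mat_trace_def units_of_def ring_mat_def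
        monoid.one_closed[OF group.is_monoid])
qed

section \<open>Orders modulo a normal subgroup and powers of the extended character\<close>

context normal
begin

text \<open>The n-th power of the coset of g is the coset of g^n, which is trivial exactly when g^n
  lies in H.\<close>

lemma quotient_ord_dvd_iff:
  assumes "g \<in> carrier G"
  shows "quotient_ord G H g dvd n \<longleftrightarrow> g [^] n \<in> H"
proof -
  interpret Q: group "G Mod H"
    by (rule factorgroup_is_group)
  have g: "H #> g \<in> carrier (G Mod H)"
    using assms by (simp add: carrier_FactGroup)
  have "quotient_ord G H g dvd n \<longleftrightarrow> H #> g [^] n = H"
    using Q.pow_eq_id[OF g, of n] assms by (simp add: quotient_ord_def FactGroup_pow)
  also have "\<dots> \<longleftrightarrow> g [^] n \<in> H"
    using assms coset_join1[OF _ _ subgroup_axioms] coset_join2[OF _ subgroup_axioms] subset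
    by (metis nat_pow_closed)
  finally show ?thesis .
qed

lemma quotient_ord_dvd_order:
  assumes "finite (carrier G)" "g \<in> carrier G"
  shows "quotient_ord G H g dvd Coset.order (G Mod H)"
proof -
  interpret Q: group "G Mod H"
    by (rule factorgroup_is_group)
  show ?thesis
    unfolding quotient_ord_def
    using assms by (intro Q.ord_dvd_group_order) (simp add: carrier_FactGroup)
qed

text \<open>\<open>ord\<close> is 0 for elements of infinite order. This is excluded because g^|G| =
  1 lies in H, so the order divides |G| > 0.\<close>

lemma quotient_ord_pos:
  assumes "finite (carrier G)" "g \<in> carrier G"
  shows "quotient_ord G H g > 0"
proof -
  have "quotient_ord G H g dvd Coset.order G"
    using assms pow_order_eq_1[of g] by (simp add: quotient_ord_dvd_iff)
  thus ?thesis
    using assms order_gt_0_iff_finite by (metis dvd_0_left gr0I)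
qed

text \<open>H is closed under inverses, so both orders have the same multiples and therefore
  coincide.\<close>

lemma quotient_ord_inv:
  assumes "g \<in> carrier G"
  shows "quotient_ord G H (inv g) = quotient_ord G H g"
proof -
  have "(inv g) [^] n \<in> H \<longleftrightarrow> g [^] n \<in> H" for n :: nat
    using assms by (metis inv_inv m_inv_closed nat_pow_closed nat_pow_inv)
  thus ?thesis
    using assms by (metis dvd_antisym dvd_refl inv_closed quotient_ord_dvd_iff)
qed

lemma linear_character_pow:
  assumes "\<zeta> \<in> characters_of_dim (G\<lparr>carrier := H\<rparr>) 1" "x \<in> H"
  shows "\<zeta> (x [^] (n::nat)) = \<zeta> x ^ n"
proof -
  interpret N: group "G\<lparr>carrier := H\<rparr>"
    by (rule subgroup_is_group) (rule is_group)
  have closed: "x [^] n \<in> H" for n :: nat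
    using assms(2) by (induction n) auto
  show ?thesis
    using linear_character_one[OF assms(1) N.is_group]
      linear_character_mult[OF assms(1) N.is_group] closed assms(2)
    by (induction n) simp_all
qed

text \<open>For multiples n of h, multiplicativity of \<zeta> applies to g^n = (g^h)^(n div h). Up
  to the factor m this is the periodic shape that \<open>lambda_series_at_periodic\<close> asks
  for.\<close>

lemma extended_character_pow:
  assumes \<zeta>: "\<zeta> \<in> characters_of_dim (G\<lparr>carrier := H\<rparr>) 1"
    and g: "g \<in> carrier G"
  defines "h \<equiv> quotient_ord G H g"
  shows "(if g [^] (n::nat) \<in> H then \<zeta> (g [^] n) else 0) =
    (if h dvd n then \<zeta> (g [^] h) ^ (n div h) else 0)"
proof -
  have "\<zeta> (g [^] n) = \<zeta> (g [^] h) ^ (n div h)" if "h dvd n"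
  proof -
    have "g [^] h \<in> H"
      using g by (simp add: h_def flip: quotient_ord_dvd_iff)
    hence "\<zeta> (g [^] h) ^ (n div h) = \<zeta> ((g [^] h) [^] (n div h))"
      by (simp add: linear_character_pow[OF \<zeta>])
    also have "(g [^] h) [^] (n div h) = g [^] n"
      using g that by (simp add: nat_pow_pow)
    finally show ?thesis by simp
  qed
  thus ?thesis
    using g by (simp add: h_def quotient_ord_dvd_iff)
qed

end

section \<open>Closed formulas for the multiple of the extended character\<close>

theorem theorem5p5p1:
  fixes G :: "('a, 'b) monoid_scheme"
    and N :: "'a set"
    and k m :: nat
    and \<chi> :: "nat \<Rightarrow> 'a \<Rightarrow> complex"
    and \<zeta> \<zeta>\<^sub>0 :: "'a \<Rightarrow> complex"
  assumes "group G" and "finite (carrier G)"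
    and "bij_betw \<chi> {1..k} (irreducible_characters G)"
    and "normal N G" and "N \<subseteq> center G"
    and "\<zeta> \<in> characters_of_dim (G\<lparr>carrier := N\<rparr>) 1"
    and "\<zeta>\<^sub>0 = (\<lambda>g. if g \<in> N then \<zeta> g else 0)"
    and "m \<ge> 1"
    and "(\<lambda>g. of_nat m * \<zeta>\<^sub>0 g) \<in> characters G"
  shows "(\<forall>g \<in> carrier G. let h = quotient_ord G N g in
            series_at (lambda_series G (\<lambda>x. of_nat m * \<zeta>\<^sub>0 x)) g =
              one_plus_power (- (fps_const (\<zeta> (g [^]\<^bsub>G\<^esub> h)) * (- fps_X) ^ h))
                (of_nat m / of_nat h))
       \<and> (\<forall>j \<in> {1..k}.
            char_inner_series G (\<chi> j) (sym_series G (\<lambda>x. of_nat m * \<zeta>\<^sub>0 x)) =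
              fps_const (1 / of_nat (Coset.order G)) *
              (\<Sum>g \<in> carrier G. let h = quotient_ord G N g in
                 fps_const (\<chi> j g) *
                 one_plus_power (- (fps_const (\<zeta> (g [^]\<^bsub>G\<^esub> (- int h))) * fps_X ^ h))
                   (- (of_nat m / of_nat h)))
          \<and> char_inner_series G (\<chi> j) (lambda_series G (\<lambda>x. of_nat m * \<zeta>\<^sub>0 x)) =
              fps_const (1 / of_nat (Coset.order G)) *
              (\<Sum>g \<in> carrier G. let h = quotient_ord G N g in
                 fps_const (\<chi> j g) *
                 one_plus_power (- (fps_const (\<zeta> (g [^]\<^bsub>G\<^esub> (- int h))) * (- fps_X) ^ h))
                   (of_nat m / of_nat h)))
       \<and> (\<forall>n \<ge> 1. gcd n (Coset.order (G Mod N)) = 1 \<longrightarrow>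
            sym_op G n (\<lambda>x. of_nat m * \<zeta>\<^sub>0 x) =
              (\<lambda>x. of_nat ((m + n - 1) choose n) * \<zeta>\<^sub>0 x ^ n)
          \<and> lambda_op G n (\<lambda>x. of_nat m * \<zeta>\<^sub>0 x) =
              (\<lambda>x. of_nat (m choose n) * \<zeta>\<^sub>0 x ^ n))"
proof -
  interpret normal N G by fact
  define f where "f = (\<lambda>x. of_nat m * \<zeta>\<^sub>0 x)"
  define h where "h = quotient_ord G N"
  have h_pos: "h g > 0" if "g \<in> carrier G" for g
    using quotient_ord_pos assms(2) that by (simp add: h_def)
  have f_pow: "f (g [^]\<^bsub>G\<^esub> n) =
      (if h g dvd n then of_nat m * \<zeta> (g [^]\<^bsub>G\<^esub> h g) ^ (n div h g) else 0)"
    if "g \<in> carrier G" for g and n :: nat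
    using extended_character_pow[OF assms(6) that, of n] by (simp add: f_def h_def assms(7))
  have lambda_at: "series_at (lambda_series G f) g =
      one_plus_power (- (fps_const (\<zeta> (g [^]\<^bsub>G\<^esub> h g)) * (- fps_X) ^ h g)) (of_nat m / of_nat (h g))"
    and sym_at: "series_at (sym_series G f) g =
      one_plus_power (- (fps_const (\<zeta> (g [^]\<^bsub>G\<^esub> h g)) * fps_X ^ h g)) (- (of_nat m / of_nat (h g)))"
    if "g \<in> carrier G" for g
    by (rule lambda_series_at_periodic[OF that h_pos[OF that] f_pow[OF that]],
      rule sym_series_at_periodic[OF that h_pos[OF that] f_pow[OF that]])
  \<comment> \<open>The inner product evaluates the series at inverses; these facts rewrite the
    closed forms there in terms of g.\<close>
  have inv_at: "h (inv\<^bsub>G\<^esub> g) = h g" "(inv\<^bsub>G\<^esub> g) [^]\<^bsub>G\<^esub> h g = g [^]\<^bsub>G\<^esub> (- int (h g))"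
    if "g \<in> carrier G" for g
    using that by (simp_all add: h_def quotient_ord_inv int_pow_neg_int nat_pow_inv)
  \<comment> \<open>The identities in degree n are between functions on the whole type. Off the
    carrier the Adams operations vanish and both series are the constant 1, so all coefficients of
    positive degree are 0 there.\<close>
  have outside: "fps_nth (lambda_series G f) n g = (if n = 0 then 1 else 0)"
    "fps_nth (sym_series G f) n g = (if n = 0 then 1 else 0)"
    if "g \<notin> carrier G" for g n
  proof -
    have "(\<lambda>i. fps_nth (adams_series G f) i g) = fps_nth 0"
      using that by (simp add: adams_series_def adams_def fun_eq_iff)
    hence "fps_nth (lambda_series G f) n g = fps_nth 1 n" for n
      using lambda_coeff_eqI[of 1 0 n] by (simp add: lambda_series_nth)
    \<comment> \<open>Writing the constant 1 as a binomial power makes \<open>sym_series_at\<close>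
      applicable.\<close>
    hence L: "series_at (lambda_series G f) g = one_plus_power 0 0"
      by (simp add: series_at_def fps_eq_iff one_plus_power_def)
    show "fps_nth (lambda_series G f) n g = (if n = 0 then 1 else 0)"
      using L by (simp add: series_at_def fps_eq_iff one_plus_power_def)
    show "fps_nth (sym_series G f) n g = (if n = 0 then 1 else 0)"
      using sym_series_at[OF L] by (simp add: series_at_def fps_eq_iff one_plus_power_def)
  qed
  have coprime_degree: "fps_nth (lambda_series G f) n g = of_nat (m choose n) * \<zeta>\<^sub>0 g ^ n \<and>
      fps_nth (sym_series G f) n g = of_nat ((m + n - 1) choose n) * \<zeta>\<^sub>0 g ^ n"
    if n: "n \<ge> 1" "gcd n (Coset.order (G Mod N)) = 1" for n g
  proof (cases "g \<in> carrier G")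
    case False
    thus ?thesis
      using n outside assms(7) mem_carrier by (auto simp: power_0_left)
  next
    case g: True
    have lambda_nth: "fps_nth (lambda_series G f) n g = (if h g dvd n then
        (of_nat m / of_nat (h g) gchoose (n div h g)) * (- ((- 1) ^ h g * \<zeta> (g [^]\<^bsub>G\<^esub> h g))) ^ (n div h g) else 0)"
      using arg_cong[OF lambda_at[OF g], of "\<lambda>F. fps_nth F n"]
        one_plus_power_monomial_nth[OF h_pos[OF g], of "- ((- 1) ^ h g * \<zeta> (g [^]\<^bsub>G\<^esub> h g))"]
      by (simp add: series_at_def fps_const_uminus_X_power flip: fps_const_neg)
    have sym_nth: "fps_nth (sym_series G f) n g = (if h g dvd n then
        (- (of_nat m / of_nat (h g)) gchoose (n div h g)) * (- \<zeta> (g [^]\<^bsub>G\<^esub> h g)) ^ (n div h g) else 0)"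
      using arg_cong[OF sym_at[OF g], of "\<lambda>F. fps_nth F n"]
        one_plus_power_monomial_nth[OF h_pos[OF g], of "- \<zeta> (g [^]\<^bsub>G\<^esub> h g)"]
      by (simp add: series_at_def flip: fps_const_neg)
    have h1: "h g = 1 \<longleftrightarrow> g \<in> N"
      using quotient_ord_dvd_iff[OF g, of 1] g by (simp add: h_def)
    show ?thesis
    proof (cases "g \<in> N")
      case True
      \<comment> \<open>Negating the upper index produces a sign (-1)^n, which cancels against that
        of (- \<zeta> g)^n. As m \<ge> 1, the natural subtraction in \<open>m + n - 1\<close> is not
        truncated.\<close>
      have "(- of_nat m gchoose n) = (- 1) ^ n * (of_nat ((m + n - 1) choose n) :: complex)"
        using gbinomial_minus[of "of_nat m :: complex" n] assms(8)
        by (simp add: binomial_gbinomial of_nat_diff)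
      moreover have "(- \<zeta> g) ^ n = (- 1) ^ n * \<zeta> g ^ n"
        by (rule power_minus)
      ultimately show ?thesis
        using True h1 g lambda_nth sym_nth
        by (simp add: assms(7) binomial_gbinomial flip: power_mult_distrib)
    next
      case False
      \<comment> \<open>Otherwise h would divide both n and |G/N|, which forces h = 1 and hence g in
        N.\<close>
      have "\<not> h g dvd n"
        using False h1 n quotient_ord_dvd_order[OF assms(2) g]
        by (metis gcd_greatest h_def nat_dvd_1_iff_1)
      thus ?thesis
        using False n lambda_nth sym_nth by (simp add: assms(7))
    qed
  qed
  show ?thesis
    unfolding f_def[symmetric] h_def[symmetric] Let_def
  proof (intro conjI ballI allI impI)
    fix g assume "g \<in> carrier G"
    thus "series_at (lambda_series G f) g = one_plus_power
        (- (fps_const (\<zeta> (g [^]\<^bsub>G\<^esub> h g)) * (- fps_X) ^ h g)) (of_nat m / of_nat (h g))"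
      by (rule lambda_at)
  next
    fix j
    show "char_inner_series G (\<chi> j) (sym_series G f) = fps_const (1 / of_nat (Coset.order G)) *
        (\<Sum>g \<in> carrier G. fps_const (\<chi> j g) *
          one_plus_power (- (fps_const (\<zeta> (g [^]\<^bsub>G\<^esub> (- int (h g)))) * fps_X ^ h g))
            (- (of_nat m / of_nat (h g))))"
      unfolding char_inner_series_eq[OF assms(1)]
      by (intro arg_cong2[where f = "(*)"] sum.cong refl) (simp add: sym_at inv_at)
    show "char_inner_series G (\<chi> j) (lambda_series G f) = fps_const (1 / of_nat (Coset.order G)) *
        (\<Sum>g \<in> carrier G. fps_const (\<chi> j g) *
          one_plus_power (- (fps_const (\<zeta> (g [^]\<^bsub>G\<^esub> (- int (h g)))) * (- fps_X) ^ h g))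
            (of_nat m / of_nat (h g)))"
      unfolding char_inner_series_eq[OF assms(1)]
      by (intro arg_cong2[where f = "(*)"] sum.cong refl) (simp add: lambda_at inv_at)
  next
    fix n assume "n \<ge> 1" "gcd n (Coset.order (G Mod N)) = 1"
    thus "sym_op G n f = (\<lambda>x. of_nat ((m + n - 1) choose n) * \<zeta>\<^sub>0 x ^ n)"
      and "lambda_op G n f = (\<lambda>x. of_nat (m choose n) * \<zeta>\<^sub>0 x ^ n)"
      by (simp_all add: sym_op_def lambda_op_def fun_eq_iff coprime_degree)
  qed
qed

end
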